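(* Let $Q_0 \subset \mathbb{R}^n$ be a bounded cube and let $1 < p \leq q < \infty$. If $f : Q_0 \to \mathbb{R}$ is a nonnegative function such that $f^{1/p} \in JN_p(Q_0)$, then $f^{1/q} \in JN_q(Q_0)$.
   Context: All cubes in $\mathbb{R}^n$ have edges parallel to the coordinate axes. For an integrable function $h$ on a cube $Q$ write $h_Q := \frac{1}{|Q|}\int_Q h$. For a bounded cube $Q_0 \subset \mathbb{R}^n$ and $1<p<\infty$, a function $h$ belongs to $JN_p(Q_0)$ if $h \in L^1(Q_0)$ and there is a constant $K<\infty$ such that $\sum_{i=1}^\infty |Q_i| \left( \frac{1}{|Q_i|}\int_{Q_i} |h - h_{Q_i}| \right)^p \leq K^p$ for all countable collections of pairwise disjoint cubes $(Q_i)_{i=1}^\infty$ contained in $Q_0$. *)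

theory Defs
  imports "HOL-Analysis.Analysis"
begin

text \<open>
  A cube is a product of intervals of a common finite side length \<open>l > 0\<close>. Each of these intervals
  may be open, closed or half-open, so that no convention about the boundary is built in; in
  particular both partitions of a cube into half-open cubes and families of open or of closed cubes
  are covered by the pairwise disjoint collections below.
\<close>

definition cube :: "(real ^ 'n::finite) set \<Rightarrow> bool" where
  "cube Q \<longleftrightarrow> (\<exists>(a :: real ^ 'n) l I. 0 < l
      \<and> (\<forall>i. {a $ i<..<a $ i + l} \<subseteq> I i \<and> I i \<subseteq> {a $ i..a $ i + l})
      \<and> Q = {x. \<forall>i. x $ i \<in> I i})"

definition average :: "(real ^ 'n::finite) set \<Rightarrow> (real ^ 'n \<Rightarrow> real) \<Rightarrow> real" where
  "average Q h = (1 / measure lebesgue Q) * (LINT x:Q|lebesgue. h x)"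

text \<open>
  A function on \<open>Q0\<close> is represented by a total function; only its values on \<open>Q0\<close> matter.
  Collections of cubes may be finite or countably infinite. Summability is required explicitly
  because \<^const>\<open>infsum\<close> is \<open>0\<close> on divergent real families.
\<close>

definition JN :: "real \<Rightarrow> (real ^ 'n::finite) set \<Rightarrow> (real ^ 'n \<Rightarrow> real) set" where
  "JN p Q0 = {h. set_integrable lebesgue Q0 h \<and>
     (\<exists>K\<ge>0. \<forall>\<Q>. countable \<Q> \<and> (\<forall>Q\<in>\<Q>. cube Q \<and> Q \<subseteq> Q0) \<and> pairwise disjnt \<Q> \<longrightarrow>
        (\<lambda>Q. measure lebesgue Q * average Q (\<lambda>x. \<bar>h x - average Q h\<bar>) powr p) summable_on \<Q> \<and>
        (\<Sum>\<^sub>\<infinity>Q\<in>\<Q>. measure lebesgue Q * average Q (\<lambda>x. \<bar>h x - average Q h\<bar>) powr p) \<le> K powr p)}"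

end

theory Submission
  imports Defs
begin

text \<open>
  Put \<open>h = f powr (1/p)\<close> and \<open>\<theta> = p/q \<in> (0,1]\<close>, so that \<open>f powr (1/q) = h powr \<theta>\<close>. The point is
  that on each single cube the mean oscillation of \<open>h powr \<theta>\<close> is at most twice the \<open>\<theta>\<close>-th power of
  the mean oscillation of \<open>h\<close>. Since \<open>\<theta> * q = p\<close>, raising this to the power \<open>q\<close> bounds every term of
  a \<open>JN\<^sub>q\<close> sum by \<open>2 powr q\<close> times the corresponding term of the \<open>JN\<^sub>p\<close> sum over the same cubes.

  The bound on one cube \<open>Q\<close> (lemma \<open>mean_oscillation_powr_le\<close>) combines three facts. A mean oscillation
  is at most twice the mean deviation from an arbitrary constant, here \<open>(average Q h) powr \<theta>\<close>. The map
  \<open>t \<mapsto> t powr \<theta>\<close> is \<open>\<theta>\<close>-Hoelder continuous with constant 1, which replaces the deviation of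
  \<open>h powr \<theta>\<close> by the \<open>\<theta>\<close>-th power of the deviation of \<open>h\<close>. Finally, by concavity, the average of a
  \<open>\<theta>\<close>-th power is at most the \<open>\<theta>\<close>-th power of the average.
\<close>

section \<open>Measure of a cube\<close>

text \<open>
  Whichever boundary points the cube contains, it differs from the open box by a part of the boundary,
  which is negligible.
\<close>

lemma cube_lmeasurable:
  fixes Q :: "(real ^ 'n::finite) set"
  assumes "cube Q"
  shows "Q \<in> lmeasurable"
    and "0 < measure lebesgue Q"
proof -
  obtain a :: "real ^ 'n" and l I where l: "0 < l"
    and I: "\<And>i. {a $ i<..<a $ i + l} \<subseteq> I i \<and> I i \<subseteq> {a $ i..a $ i + l}"
    and Q: "Q = {x. \<forall>i. x $ i \<in> I i}"
    using assms unfolding cube_def by blast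
  define b where "b = (\<chi> i. a $ i + l)"
  have sub1: "box a b \<subseteq> Q"
    using I by (force simp: Q b_def mem_box_cart subset_iff)
  have sub2: "Q \<subseteq> cbox a b"
    using I by (force simp: Q b_def mem_box_cart subset_iff)
  have "negligible (Q - box a b)"
    by (rule negligible_subset[OF negligible_frontier_interval[of a b]]) (use sub2 in auto)
  then have "box a b \<union> (Q - box a b) \<in> lmeasurable"
    by (intro fmeasurable.Un) (simp_all add: negligible_iff_measure)
  with sub1 show meas: "Q \<in> lmeasurable"
    by (simp add: Un_absorb1 Un_Diff_cancel)
  have "box a b \<noteq> {}"
    using l by (simp add: interval_ne_empty_cart b_def)
  then have "\<not> negligible Q"
    using open_not_negligible[of "box a b"] negligible_subset[OF _ sub1] by auto
  then show "0 < measure lebesgue Q"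
    using meas by (simp add: negligible_iff_measure zero_less_measure_iff)
qed

section \<open>Averages and mean oscillation\<close>

lemma set_integrable_const_lmeasurable:
  assumes "Q \<in> lmeasurable"
  shows "set_integrable lebesgue Q (\<lambda>_. c :: real)"
  using assms unfolding set_integrable_def
  by (simp add: lmeasurable_iff_integrable)

lemma average_const:
  assumes "Q \<in> lmeasurable" "0 < measure lebesgue Q"
  shows "average Q (\<lambda>_. c) = c"
  using assms
  by (simp add: average_def set_lebesgue_integral_def fmeasurableD)

lemma average_add:
  assumes "set_integrable lebesgue Q g" "set_integrable lebesgue Q h"
  shows "average Q (\<lambda>x. g x + h x) = average Q g + average Q h"
  using assms by (simp add: average_def set_integral_add distrib_left)

lemma average_diff:
  assumes "set_integrable lebesgue Q g" "set_integrable lebesgue Q h"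
  shows "average Q (\<lambda>x. g x - h x) = average Q g - average Q h"
  using assms by (simp add: average_def set_integral_diff right_diff_distrib)

lemma average_cmult: "average Q (\<lambda>x. c * h x) = c * average Q h"
  by (simp add: average_def)

lemma average_mono:
  assumes "set_integrable lebesgue Q g" "set_integrable lebesgue Q h"
    and "\<And>x. x \<in> Q \<Longrightarrow> g x \<le> h x"
  shows "average Q g \<le> average Q h"
  unfolding average_def using assms
  by (intro mult_left_mono set_integral_mono) auto

lemma average_nonneg:
  assumes "\<And>x. x \<in> Q \<Longrightarrow> 0 \<le> h x"
  shows "0 \<le> average Q h"
  unfolding average_def set_lebesgue_integral_def using assms
  by (intro mult_nonneg_nonneg integral_nonneg_AE) (auto simp: indicator_def)

lemma abs_average_le: "\<bar>average Q h\<bar> \<le> average Q (\<lambda>x. \<bar>h x\<bar>)"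
proof -
  have "\<bar>LINT x:Q|lebesgue. h x\<bar> \<le> (LINT x:Q|lebesgue. \<bar>h x\<bar>)"
    using integral_abs_bound[of lebesgue "\<lambda>x. indicator Q x *\<^sub>R h x"]
    by (simp add: set_lebesgue_integral_def abs_mult)
  then show ?thesis
    by (simp add: average_def abs_mult divide_right_mono)
qed

text \<open>
  By the triangle inequality: replacing the average by another constant \<open>c\<close> costs
  \<open>\<bar>c - average Q g\<bar>\<close>, which is itself at most the mean deviation from \<open>c\<close>.
\<close>

lemma mean_oscillation_le_deviation:
  assumes Q: "Q \<in> lmeasurable" "0 < measure lebesgue Q"
    and g: "set_integrable lebesgue Q g"
  shows "average Q (\<lambda>x. \<bar>g x - average Q g\<bar>) \<le> 2 * average Q (\<lambda>x. \<bar>g x - c\<bar>)"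
proof -
  note const = set_integrable_const_lmeasurable[OF Q(1)]
  have dev: "set_integrable lebesgue Q (\<lambda>x. \<bar>g x - d\<bar>)" for d
    by (intro set_integrable_abs set_integral_diff(1) g const)
  have "average Q (\<lambda>x. \<bar>g x - average Q g\<bar>)
      \<le> average Q (\<lambda>x. \<bar>g x - c\<bar> + \<bar>average Q g - c\<bar>)"
    by (intro average_mono dev set_integral_add(1) const) auto
  also have "\<dots> = average Q (\<lambda>x. \<bar>g x - c\<bar>) + \<bar>average Q g - c\<bar>"
    by (simp add: average_add[OF dev const] average_const[OF Q])
  also have "average Q g - c = average Q (\<lambda>x. g x - c)"
    by (simp add: average_diff[OF g const] average_const[OF Q])
  also have "\<bar>\<dots>\<bar> \<le> average Q (\<lambda>x. \<bar>g x - c\<bar>)"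
    by (rule abs_average_le)
  finally show ?thesis by simp
qed

section \<open>Powers with exponent at most one\<close>

text \<open>
  Normalise by \<open>a + b\<close>: the numbers \<open>a / (a + b)\<close> and \<open>b / (a + b)\<close> lie in \<open>[0,1]\<close> and add up to 1,
  and a power with exponent at most 1 does not decrease a number in \<open>[0,1]\<close>.
\<close>

lemma powr_add_le:
  fixes a b t :: real
  assumes "0 \<le> a" "0 \<le> b" "0 < t" "t \<le> 1"
  shows "(a + b) powr t \<le> a powr t + b powr t"
proof (cases "a + b = 0")
  case True
  then show ?thesis using assms by simp
next
  case False
  define s where "s = a + b"
  have s: "0 < s" using False assms by (simp add: s_def)
  have ge: "u / s * s powr t \<le> u powr t" if "0 \<le> u" "u \<le> s" for u
  proof -
    have "u / s \<le> (u / s) powr t"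
      using powr_mono'[of t 1 "u / s"] that s assms by simp
    then show ?thesis
      using that s by (simp add: powr_divide field_simps)
  qed
  have "s powr t = a / s * s powr t + b / s * s powr t"
    using s by (simp add: s_def flip: distrib_right add_divide_distrib)
  also have "\<dots> \<le> a powr t + b powr t"
    using assms by (intro add_mono ge) (auto simp: s_def)
  finally show ?thesis by (simp add: s_def)
qed

lemma abs_powr_diff_le:
  fixes a b t :: real
  assumes "0 \<le> a" "0 \<le> b" "0 < t" "t \<le> 1"
  shows "\<bar>a powr t - b powr t\<bar> \<le> \<bar>a - b\<bar> powr t"
proof -
  have *: "v powr t - u powr t \<le> (v - u) powr t" if "0 \<le> u" "u \<le> v" for u v
    using powr_add_le[of u "v - u" t] that assms by simp
  show ?thesis
    using *[of a b] *[of b a] assms powr_mono2[of t a b] powr_mono2[of t b a]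
    by (cases "a \<le> b") (auto simp: abs_if)
qed

text \<open>On a set of finite measure \<open>1 + h\<close> is an integrable majorant.\<close>

lemma set_integrable_powr:
  fixes h :: "real ^ 'n::finite \<Rightarrow> real"
  assumes Q: "Q \<in> lmeasurable" and h: "set_integrable lebesgue Q h"
    and nonneg: "\<And>x. x \<in> Q \<Longrightarrow> 0 \<le> h x" and t: "0 < t" "t \<le> 1"
  shows "set_integrable lebesgue Q (\<lambda>x. h x powr t)"
proof (rule set_integrable_bound)
  show "set_integrable lebesgue Q (\<lambda>x. 1 + h x)"
    by (intro set_integral_add(1) h set_integrable_const_lmeasurable Q)
  have "(\<lambda>x. (indicator Q x *\<^sub>R h x) powr t) \<in> borel_measurable lebesgue"
    using h unfolding set_integrable_def by (intro powr_real_measurable) auto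
  moreover have "(\<lambda>x. (indicator Q x *\<^sub>R h x) powr t) = (\<lambda>x. indicator Q x *\<^sub>R h x powr t)"
    by (auto simp: indicator_def)
  ultimately show "set_borel_measurable lebesgue Q (\<lambda>x. h x powr t)"
    by (simp add: set_borel_measurable_def)
  have "u powr t \<le> 1 + u" if "0 \<le> u" for u :: real
  proof -
    have "u powr t \<le> (1 + u) powr t"
      using that t by (intro powr_mono2) auto
    also have "\<dots> \<le> 1 + u"
      using powr_mono[of t 1 "1 + u"] that t by simp
    finally show ?thesis .
  qed
  then show "AE x in lebesgue. x \<in> Q \<longrightarrow> norm (h x powr t) \<le> norm (1 + h x)"
    using nonneg by auto
qed

text \<open>
  Jensen's inequality for the concave function \<open>u \<mapsto> u powr t\<close>. Young's inequality bounds this function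
  by its tangent at any point \<open>B > 0\<close>, and averaging keeps this affine bound. The tangency point is taken
  slightly above the average \<open>A\<close> of \<open>h\<close>, and \<open>B\<close> then tends to \<open>A\<close>; this covers \<open>A = 0\<close>,
  where there is no tangent.
\<close>

lemma average_powr_le:
  fixes h :: "real ^ 'n::finite \<Rightarrow> real"
  assumes Q: "Q \<in> lmeasurable" "0 < measure lebesgue Q" and h: "set_integrable lebesgue Q h"
    and nonneg: "\<And>x. x \<in> Q \<Longrightarrow> 0 \<le> h x" and t: "0 < t" "t \<le> 1"
  shows "average Q (\<lambda>x. h x powr t) \<le> average Q h powr t"
proof -
  define A where "A = average Q h"
  have A: "0 \<le> A" unfolding A_def using nonneg by (rule average_nonneg)
  note const = set_integrable_const_lmeasurable[OF Q(1)]
  have le: "average Q (\<lambda>x. h x powr t) \<le> B powr t" if B: "A < B" for B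
  proof -
    have Bpos: "0 < B" using A B by simp
    define m where "m = t * B powr (t - 1)"
    have m: "0 \<le> m" "m * B = t * B powr t"
      using t Bpos by (auto simp: m_def powr_diff)
    have tangent: "u powr t \<le> (1 - t) * B powr t + m * u" if u: "0 \<le> u" for u
    proof (cases "u = 0")
      case True
      then show ?thesis using t by simp
    next
      case False
      have "u powr t * B powr (1 - t) \<le> t * u + (1 - t) * B"
        using Youngs_inequality_0[of t "1 - t" u B] False u Bpos t by simp
      then have "u powr t * B powr (1 - t) * B powr (t - 1)
          \<le> (t * u + (1 - t) * B) * B powr (t - 1)"
        by (intro mult_right_mono) auto
      moreover have "B powr (1 - t) * B powr (t - 1) = 1"
        using Bpos by (simp flip: powr_add)
      moreover have "B * B powr (t - 1) = B powr t"
        using Bpos by (simp add: powr_diff)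
      ultimately show ?thesis
        by (simp add: m_def distrib_right mult.assoc mult.left_commute[of u] mult.commute[of u])
    qed
    have mh: "set_integrable lebesgue Q (\<lambda>x. m * h x)"
      using h by simp
    have "average Q (\<lambda>x. h x powr t) \<le> average Q (\<lambda>x. (1 - t) * B powr t + m * h x)"
      by (intro average_mono set_integrable_powr Q h nonneg t set_integral_add(1) const mh tangent)
    also have "\<dots> = (1 - t) * B powr t + m * A"
      by (simp add: average_add[OF const mh] average_const[OF Q] average_cmult A_def)
    also have "\<dots> \<le> (1 - t) * B powr t + m * B"
      using m(1) B by (intro add_left_mono mult_left_mono) auto
    also have "\<dots> = B powr t"
      by (simp add: m(2) left_diff_distrib)
    finally show ?thesis .
  qed
  have "((\<lambda>B. B powr t) \<longlongrightarrow> A powr t) (at_right A)"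
  proof (rule tendsto_powr')
    show "A \<noteq> 0 \<or> 0 < t \<and> (\<forall>\<^sub>F B in at_right A. 0 \<le> B)"
      using A t by (intro disjI2 conjI eventually_at_rightI[of A "A + 1"]) auto
  qed (auto intro: tendsto_ident_at)
  moreover have "\<forall>\<^sub>F B in at_right A. average Q (\<lambda>x. h x powr t) \<le> B powr t"
    using le by (intro eventually_at_rightI[of A "A + 1"]) auto
  ultimately show ?thesis
    unfolding A_def[symmetric] by (rule tendsto_lowerbound) simp
qed

lemma mean_oscillation_powr_le:
  fixes h :: "real ^ 'n::finite \<Rightarrow> real"
  assumes Q: "Q \<in> lmeasurable" "0 < measure lebesgue Q" and h: "set_integrable lebesgue Q h"
    and nonneg: "\<And>x. x \<in> Q \<Longrightarrow> 0 \<le> h x" and t: "0 < t" "t \<le> 1"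
  shows "average Q (\<lambda>x. \<bar>h x powr t - average Q (\<lambda>x. h x powr t)\<bar>)
    \<le> 2 * average Q (\<lambda>x. \<bar>h x - average Q h\<bar>) powr t"
proof -
  note const = set_integrable_const_lmeasurable[OF Q(1)]
  have ht: "set_integrable lebesgue Q (\<lambda>x. h x powr t)"
    by (intro set_integrable_powr Q h nonneg t)
  have dev: "set_integrable lebesgue Q (\<lambda>x. \<bar>h x - average Q h\<bar>)"
    by (intro set_integrable_abs set_integral_diff(1) h const)
  have "average Q (\<lambda>x. \<bar>h x powr t - average Q (\<lambda>x. h x powr t)\<bar>)
      \<le> 2 * average Q (\<lambda>x. \<bar>h x powr t - average Q h powr t\<bar>)"
    by (rule mean_oscillation_le_deviation[OF Q ht])
  also have "average Q (\<lambda>x. \<bar>h x powr t - average Q h powr t\<bar>)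
      \<le> average Q (\<lambda>x. \<bar>h x - average Q h\<bar> powr t)"
    by (intro average_mono set_integrable_abs set_integral_diff(1) ht const set_integrable_powr Q dev
        abs_powr_diff_le nonneg average_nonneg t) auto
  also have "\<dots> \<le> average Q (\<lambda>x. \<bar>h x - average Q h\<bar>) powr t"
    by (intro average_powr_le Q dev t) auto
  finally show ?thesis by simp
qed

section \<open>Transfer between John-Nirenberg spaces\<close>

theorem proposition2p7:
  fixes Q0 :: "(real ^ 'n::finite) set" and f :: "real ^ 'n \<Rightarrow> real" and p q :: real
  assumes "cube Q0"
    and "1 < p" and "p \<le> q"
    and "\<And>x. x \<in> Q0 \<Longrightarrow> 0 \<le> f x"
    and "(\<lambda>x. f x powr (1 / p)) \<in> JN p Q0"
  shows "(\<lambda>x. f x powr (1 / q)) \<in> JN q Q0"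
proof -
  define h where "h = (\<lambda>x. f x powr (1 / p))"
  define t where "t = p / q"
  have t: "0 < t" "t \<le> 1" "t * q = p"
    using assms(2,3) by (auto simp: t_def)
  have q: "0 < q" using assms(2,3) by simp
  have f_eq: "(\<lambda>x. f x powr (1 / q)) = (\<lambda>x. h x powr t)"
    using assms(2) by (simp add: h_def t_def powr_powr)
  have h0: "0 \<le> h x" for x by (simp add: h_def)
  define S where "S = (\<lambda>Q. measure lebesgue Q * average Q (\<lambda>x. \<bar>h x - average Q h\<bar>) powr p)"
  define T where "T = (\<lambda>Q. measure lebesgue Q *
    average Q (\<lambda>x. \<bar>h x powr t - average Q (\<lambda>x. h x powr t)\<bar>) powr q)"
  obtain K where int: "set_integrable lebesgue Q0 h" and K: "0 \<le> K"
    and sums: "\<forall>\<Q>. countable \<Q> \<and> (\<forall>Q\<in>\<Q>. cube Q \<and> Q \<subseteq> Q0) \<and> pairwise disjnt \<Q>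
        \<longrightarrow> S summable_on \<Q> \<and> infsum S \<Q> \<le> K powr p"
    using assms(5) unfolding JN_def h_def[symmetric] S_def
    by (elim CollectE conjE exE) (rule that[unfolded S_def])
  have term_le: "T Q \<le> 2 powr q * S Q" if "cube Q" "Q \<subseteq> Q0" for Q
  proof -
    note Q = cube_lmeasurable[OF \<open>cube Q\<close>]
    have "set_integrable lebesgue Q h"
      using int by (rule set_integrable_subset) (use Q that in auto)
    from mean_oscillation_powr_le[OF Q this h0 t(1,2)]
    have "average Q (\<lambda>x. \<bar>h x powr t - average Q (\<lambda>x. h x powr t)\<bar>) powr q
        \<le> (2 * average Q (\<lambda>x. \<bar>h x - average Q h\<bar>) powr t) powr q"
      using q by (intro powr_mono2 average_nonneg) auto
    also have "\<dots> = 2 powr q * average Q (\<lambda>x. \<bar>h x - average Q h\<bar>) powr p"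
      by (simp add: powr_mult powr_powr t)
    finally show ?thesis
      unfolding S_def T_def by (simp add: mult_left_mono mult.left_commute)
  qed
  have "T summable_on \<Q> \<and> infsum T \<Q> \<le> (2 * K powr t) powr q"
    if \<Q>: "countable \<Q>" "\<forall>Q\<in>\<Q>. cube Q \<and> Q \<subseteq> Q0" "pairwise disjnt \<Q>" for \<Q>
  proof -
    have S: "S summable_on \<Q>" "infsum S \<Q> \<le> K powr p" using sums \<Q> by auto
    then have S2: "(\<lambda>Q. 2 powr q * S Q) summable_on \<Q>"
      by (intro summable_on_cmult_right)
    then have T: "T summable_on \<Q>"
      by (rule summable_on_comparison_test) (use \<Q>(2) term_le in \<open>auto simp: T_def\<close>)
    have "infsum T \<Q> \<le> (\<Sum>\<^sub>\<infinity>Q\<in>\<Q>. 2 powr q * S Q)"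
      using T S2 \<Q>(2) term_le by (intro infsum_mono) auto
    also have "\<dots> = 2 powr q * infsum S \<Q>"
      by (rule infsum_cmult_right) (use S in auto)
    also have "\<dots> \<le> 2 powr q * K powr p"
      using S by (intro mult_left_mono) auto
    also have "\<dots> = (2 * K powr t) powr q"
      by (simp add: powr_mult powr_powr t)
    finally show ?thesis using T by simp
  qed
  moreover have "set_integrable lebesgue Q0 (\<lambda>x. h x powr t)"
    by (intro set_integrable_powr cube_lmeasurable assms(1) int h0 t)
  ultimately show ?thesis
    unfolding f_eq JN_def T_def by (intro CollectI conjI exI[of _ "2 * K powr t"]) auto
qed

end
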